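(* Let $k\ge 0$ be an integer. The classes of upper $k$-gap balancer pairs corresponding to conjugate classes of upper $k$-gap balancing pairs are conjugate. That is, if $((B_i,C_i))_{i\ge 0}$ and $((\overline B_i,\overline C_i))_{i\ge 0}$ are conjugate classes of upper $k$-gap balancing pairs with associated upper $k$-gap balancer pairs $((r_i,\hat r_i))_{i\ge0}$ and $((\overline r_i,\hat{\overline r}_i))_{i\ge0}$, then these two classes of upper $k$-gap balancer pairs are conjugate.
   Context: Let $k\ge 0$ be an integer and $T(i)=\frac{i(i+1)}{2}$. An integer $B\ge k$ is an upper $k$-gap balancing number if there is an integer $r\ge 0$ with $1+2+\dots+(B-k)=(B+1)+\dots+(B+r)$ (empty sums are $0$), equivalently $T(B-k)+T(B)=T(B+r)$. (By convention $k$ is the smallest upper $k$-gap balancing number; in particular $0$ is an upper $0$-gap balancing number.) This $r$ is uniquely determined by $B$ and is called the upper $k$-gap balancer of $B$. The upper $k$-gap Lucas-balancing number of $B$ is $C=\sqrt{8B^2+8(1-k)B+(2k-1)^2}$ and the upper $k$-gap Lucas-balancer is $\hat r=\sqrt{8r^2+8kr+1}$ (nonnegative square roots). $(B,C)$ is called an upper $k$-gap balancing pair and $(r,\hat r)$ its (associated) upper $k$-gap balancer pair. A class of upper $k$-gap balancing pairs is a sequence $((B_i,C_i))_{i\ge 0}$ where $(B_0,C_0)$ is an upper $k$-gap balancing pair with $k\le B_0<4k+2$ and $B_{i+1}=3B_i+C_i+1-k$, $C_{i+1}=8B_i+3C_i+4-4k$ for $i\ge 0$ (every term is an upper $k$-gap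 balancing pair). The corresponding class of upper $k$-gap balancer pairs is $((r_i,\hat r_i))_{i\ge 0}$ with $(r_i,\hat r_i)$ the balancer pair of $(B_i,C_i)$. Conjugacy: as usual (Nagell), two integer solutions $(y,z),(y',z')$ of $y^2-2z^2=N$ belong to the same class if $y'+z'\sqrt2=(y+z\sqrt2)(u+v\sqrt2)$ for some integers $u,v$ with $u^2-2v^2=1$; the conjugate of a class $K$ is the class $\{(y,-z):(y,z)\in K\}$. The pairs $(y,z)=(C_i,2B_i+1-k)$ all lie in one class of solutions of $y^2-2z^2=2k^2-1$, and the pairs $(y,z)=(\hat r_i,2r_i+k)$ all lie in one class of solutions of $y^2-2z^2=-(2k^2-1)$. Two classes of upper $k$-gap balancing pairs (respectively balancer pairs) are conjugate if the corresponding classes of solutions of $y^2-2z^2=2k^2-1$ (respectively of $y^2-2z^2=-(2k^2-1)$) are conjugate. *)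

theory Defs
  imports Complex_Main
begin

section \<open>Upper \<open>k\<close>-gap balancing numbers and balancers\<close>

text \<open>
  The side condition \<open>k \<le> B\<close> makes the natural-number subtraction \<open>B - k\<close> exact;
  the sums are \<open>0\<close> when \<open>B = k\<close>, respectively \<open>r = 0\<close>.
\<close>

definition is_upper_gap_balancer :: "nat \<Rightarrow> nat \<Rightarrow> nat \<Rightarrow> bool" where
  "is_upper_gap_balancer k B r \<longleftrightarrow> k \<le> B \<and> (\<Sum>j = 1..B - k. j) = (\<Sum>j = B + 1..B + r. j)"

definition upper_gap_balancing :: "nat \<Rightarrow> nat \<Rightarrow> bool" where
  "upper_gap_balancing k B \<longleftrightarrow> (\<exists>r. is_upper_gap_balancer k B r)"

text \<open>
  The Lucas numbers are real square roots; that they are integers is a consequence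
  of the definitions and is not built into them.
\<close>

definition upper_gap_lucas_balancing :: "nat \<Rightarrow> nat \<Rightarrow> real" where
  "upper_gap_lucas_balancing k B =
     sqrt (8 * real B ^ 2 + 8 * (1 - real k) * real B + (2 * real k - 1) ^ 2)"

definition upper_gap_lucas_balancer :: "nat \<Rightarrow> nat \<Rightarrow> real" where
  "upper_gap_lucas_balancer k r = sqrt (8 * real r ^ 2 + 8 * real k * real r + 1)"

definition upper_gap_balancing_pair :: "nat \<Rightarrow> nat \<Rightarrow> real \<Rightarrow> bool" where
  "upper_gap_balancing_pair k B C \<longleftrightarrow>
     upper_gap_balancing k B \<and> C = upper_gap_lucas_balancing k B"

definition upper_gap_balancer_pair_of :: "nat \<Rightarrow> nat \<Rightarrow> nat \<Rightarrow> real \<Rightarrow> bool" where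
  "upper_gap_balancer_pair_of k B r rh \<longleftrightarrow>
     is_upper_gap_balancer k B r \<and> rh = upper_gap_lucas_balancer k r"

definition upper_gap_balancing_class ::
    "nat \<Rightarrow> (nat \<Rightarrow> nat) \<Rightarrow> (nat \<Rightarrow> real) \<Rightarrow> bool" where
  "upper_gap_balancing_class k B C \<longleftrightarrow>
     upper_gap_balancing_pair k (B 0) (C 0) \<and> k \<le> B 0 \<and> B 0 < 4 * k + 2 \<and>
     (\<forall>i. real (B (Suc i)) = 3 * real (B i) + C i + 1 - real k \<and>
          C (Suc i) = 8 * real (B i) + 3 * C i + 4 - 4 * real k)"

definition upper_gap_balancer_class_of ::
    "nat \<Rightarrow> (nat \<Rightarrow> nat) \<Rightarrow> (nat \<Rightarrow> real) \<Rightarrow> (nat \<Rightarrow> nat) \<Rightarrow> (nat \<Rightarrow> real) \<Rightarrow> bool" where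
  "upper_gap_balancer_class_of k B C r rh \<longleftrightarrow>
     upper_gap_balancing_class k B C \<and> (\<forall>i. upper_gap_balancer_pair_of k (B i) (r i) (rh i))"


section \<open>Classes of solutions of \<open>y\<^sup>2 - 2 z\<^sup>2 = N\<close> (Nagell) and conjugacy\<close>

definition pell_solutions :: "int \<Rightarrow> (int \<times> int) set" where
  "pell_solutions N = {(y, z). y ^ 2 - 2 * z ^ 2 = N}"

definition pell_equiv :: "int \<Rightarrow> ((int \<times> int) \<times> (int \<times> int)) set" where
  "pell_equiv N = {((y, z), (y', z')).
     (y, z) \<in> pell_solutions N \<and> (y', z') \<in> pell_solutions N \<and>
     (\<exists>u v :: int. u ^ 2 - 2 * v ^ 2 = 1 \<and>
        real_of_int y' + real_of_int z' * sqrt 2 =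
        (real_of_int y + real_of_int z * sqrt 2) * (real_of_int u + real_of_int v * sqrt 2))}"

definition pell_classes :: "int \<Rightarrow> (int \<times> int) set set" where
  "pell_classes N = pell_solutions N // pell_equiv N"

definition conjugate_class :: "(int \<times> int) set \<Rightarrow> (int \<times> int) set" where
  "conjugate_class K = (\<lambda>(y, z). (y, - z)) ` K"

text \<open>
  A sequence of real pairs lies in \<open>K\<close> if all its terms are integer pairs belonging to \<open>K\<close>.
  A class of solutions with this property is unique.
\<close>

definition lies_in :: "(nat \<Rightarrow> real \<times> real) \<Rightarrow> (int \<times> int) set \<Rightarrow> bool" where
  "lies_in s K \<longleftrightarrow> range s \<subseteq> map_prod real_of_int real_of_int ` K"

definition conjugate_sequences ::
    "int \<Rightarrow> (nat \<Rightarrow> real \<times> real) \<Rightarrow> (nat \<Rightarrow> real \<times> real) \<Rightarrow> bool" where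
  "conjugate_sequences N s s' \<longleftrightarrow>
     (\<exists>K \<in> pell_classes N. \<exists>K' \<in> pell_classes N.
        lies_in s K \<and> lies_in s' K' \<and> K' = conjugate_class K)"

definition conjugate_balancing_classes ::
    "nat \<Rightarrow> (nat \<Rightarrow> nat) \<Rightarrow> (nat \<Rightarrow> real) \<Rightarrow> (nat \<Rightarrow> nat) \<Rightarrow> (nat \<Rightarrow> real) \<Rightarrow> bool" where
  "conjugate_balancing_classes k B C B' C' \<longleftrightarrow>
     conjugate_sequences (2 * int k ^ 2 - 1)
       (\<lambda>i. (C i, 2 * real (B i) + 1 - real k))
       (\<lambda>i. (C' i, 2 * real (B' i) + 1 - real k))"

definition conjugate_balancer_classes ::
    "nat \<Rightarrow> (nat \<Rightarrow> nat) \<Rightarrow> (nat \<Rightarrow> real) \<Rightarrow> (nat \<Rightarrow> nat) \<Rightarrow> (nat \<Rightarrow> real) \<Rightarrow> bool" where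
  "conjugate_balancer_classes k r rh r' rh' \<longleftrightarrow>
     conjugate_sequences (- (2 * int k ^ 2 - 1))
       (\<lambda>i. (rh i, 2 * real (r i) + real k))
       (\<lambda>i. (rh' i, 2 * real (r' i) + real k))"

end

theory Submission imports Defs begin

text \<open>
  Identify a pair \<open>(y, z)\<close> with the number \<open>y + z \<surd>2\<close> of \<open>\<int>[\<surd>2]\<close>, whose norm is
  \<open>y\<^sup>2 - 2 z\<^sup>2\<close>.  Let \<open>B\<close> be a balancing number with balancer \<open>r\<close>.  Completing the square in
  \<open>T (B - k) + T B = T (B + r)\<close> shows \<open>C = 2 B + 2 r + 1\<close>, and hence, with \<open>z = 2 B + 1 - k\<close>,
  that \<open>2 r + k = C - z\<close> and \<open>rh = 2 z - C\<close>.  In other words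
    \<open>rh + (2 r + k) \<surd>2 = (\<surd>2 - 1) (C + z \<surd>2)\<close>:
  the passage from balancing pairs to balancer pairs is multiplication by the unit
  \<open>\<eta> = \<surd>2 - 1\<close> of norm \<open>-1\<close> (\<open>balancer_pair_is_unit_multiple\<close>).

  Multiplication by \<open>\<eta>\<close> is a bijection from the solutions for \<open>N\<close> to those for \<open>-N\<close>, and it
  commutes with multiplication by units of norm \<open>1\<close>, so it carries classes to classes
  (\<open>mult_unit_image_class\<close>).  It does not commute with conjugation, but
  \<open>\<eta> \<alpha>\<^sup>*\<close> and \<open>(\<eta> \<alpha>)\<^sup>* = \<eta>\<^sup>* \<alpha>\<^sup>*\<close> differ by the factor \<open>\<eta> / \<eta>\<^sup>* = - \<eta>\<^sup>2 = -3 + 2 \<surd>2\<close>,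
  which has norm \<open>1\<close>.  They therefore lie in the same class, and multiplication by \<open>\<eta>\<close>
  commutes with conjugation of classes (\<open>mult_unit_conjugate_class\<close>).
\<close>


section \<open>Arithmetic of \<open>\<int>[\<surd>2]\<close> and Nagell classes\<close>

lemma square_eq_double_square:
  fixes p q :: int
  assumes "p ^ 2 = 2 * q ^ 2"
  shows "q = 0"
  using assms
proof (induction "nat \<bar>q\<bar>" arbitrary: p q rule: less_induct)
  case less
  have "even (p ^ 2)" using less.prems by simp
  then obtain a where a: "p = 2 * a" by (auto elim: evenE)
  then have qa: "q ^ 2 = 2 * a ^ 2" using less.prems by (simp add: power2_eq_square)
  then have "even (q ^ 2)" by simp
  then obtain b where b: "q = 2 * b" by (auto elim: evenE)
  then have ab: "a ^ 2 = 2 * b ^ 2" using qa by (simp add: power2_eq_square)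
  show ?case
  proof (rule ccontr)
    assume "q \<noteq> 0"
    with b have "nat \<bar>b\<bar> < nat \<bar>q\<bar>" by simp
    from less.hyps[OF this ab] b \<open>q \<noteq> 0\<close> show False by simp
  qed
qed

lemma int_sqrt2_eq_iff:
  fixes a b c d :: int
  shows "real_of_int a + real_of_int b * sqrt 2 = real_of_int c + real_of_int d * sqrt 2
    \<longleftrightarrow> a = c \<and> b = d"
proof
  assume eq: "real_of_int a + real_of_int b * sqrt 2 = real_of_int c + real_of_int d * sqrt 2"
  then have "real_of_int (a - c) = real_of_int (d - b) * sqrt 2" by (simp add: algebra_simps)
  then have "real_of_int (a - c) ^ 2 = 2 * real_of_int (d - b) ^ 2"
    by (simp add: power_mult_distrib)
  then have "real_of_int ((a - c) ^ 2) = real_of_int (2 * (d - b) ^ 2)" by simp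
  then have "(a - c) ^ 2 = 2 * (d - b) ^ 2" by (simp only: of_int_eq_iff)
  then have "d - b = 0" by (rule square_eq_double_square)
  with eq show "a = c \<and> b = d" by simp
qed simp

text \<open>
  Since \<open>\<surd>2\<close> is irrational, the real equation in the definition of equivalence is an identity
  between integer coordinates, so equivalence can be handled by polynomial arithmetic.
\<close>

lemma pell_equiv_iff:
  "((y, z), (y', z')) \<in> pell_equiv N \<longleftrightarrow>
     y ^ 2 - 2 * z ^ 2 = N \<and> y' ^ 2 - 2 * z' ^ 2 = N \<and>
     (\<exists>u v. u ^ 2 - 2 * v ^ 2 = 1 \<and> y' = y * u + 2 * z * v \<and> z' = y * v + z * u)"
proof -
  have "(real_of_int y + real_of_int z * sqrt 2) * (real_of_int u + real_of_int v * sqrt 2)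
      = real_of_int (y * u + 2 * z * v) + real_of_int (y * v + z * u) * sqrt 2" for u v
    by (simp add: algebra_simps)
  then show ?thesis
    by (simp only: pell_equiv_def pell_solutions_def mem_Collect_eq case_prod_conv
        int_sqrt2_eq_iff conj_assoc)
qed

lemma equiv_pell_equiv: "equiv (pell_solutions N) (pell_equiv N)"
proof (rule equivI)
  show "pell_equiv N \<subseteq> pell_solutions N \<times> pell_solutions N"
    by (auto simp: pell_equiv_def)
  show "refl_on (pell_solutions N) (pell_equiv N)"
  proof (rule refl_onI)
    fix x assume x: "x \<in> pell_solutions N"
    obtain y z where yz: "x = (y, z)" by (cases x)
    have "1 ^ 2 - 2 * 0 ^ 2 = (1 :: int)" "y = y * 1 + 2 * z * 0" "z = y * 0 + z * 1" by simp_all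
    moreover have "y ^ 2 - 2 * z ^ 2 = N" using x by (simp add: yz pell_solutions_def)
    ultimately show "(x, x) \<in> pell_equiv N" unfolding yz pell_equiv_iff by blast
  qed
  show "sym (pell_equiv N)"
  proof (rule symI, clarify)
    fix y z y' z' assume "((y, z), (y', z')) \<in> pell_equiv N"
    then obtain u v where N: "y ^ 2 - 2 * z ^ 2 = N" "y' ^ 2 - 2 * z' ^ 2 = N"
      and uv: "u ^ 2 - 2 * v ^ 2 = 1" and y': "y' = y * u + 2 * z * v" and z': "z' = y * v + z * u"
      by (auto simp: pell_equiv_iff)
    \<comment> \<open>The inverse of a unit of norm \<open>1\<close> is its conjugate.\<close>
    have "y = y * (u ^ 2 - 2 * v ^ 2)" "z = z * (u ^ 2 - 2 * v ^ 2)" using uv by simp_all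
    then have "y = y' * u + 2 * z' * (- v)" "z = y' * (- v) + z' * u"
      unfolding y' z' by (simp_all add: algebra_simps power2_eq_square)
    moreover have "u ^ 2 - 2 * (- v) ^ 2 = 1" using uv by simp
    ultimately show "((y', z'), (y, z)) \<in> pell_equiv N"
      unfolding pell_equiv_iff using N by blast
  qed
  show "trans (pell_equiv N)"
  proof (rule transI, clarify)
    fix y z y' z' y'' z''
    assume "((y, z), (y', z')) \<in> pell_equiv N" "((y', z'), (y'', z'')) \<in> pell_equiv N"
    then obtain u v s t where N: "y ^ 2 - 2 * z ^ 2 = N" "y'' ^ 2 - 2 * z'' ^ 2 = N"
      and uv: "u ^ 2 - 2 * v ^ 2 = 1" and st: "s ^ 2 - 2 * t ^ 2 = 1"
      and y': "y' = y * u + 2 * z * v" and z': "z' = y * v + z * u"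
      and y'': "y'' = y' * s + 2 * z' * t" and z'': "z'' = y' * t + z' * s"
      by (auto simp: pell_equiv_iff)
    have "(u * s + 2 * v * t) ^ 2 - 2 * (u * t + v * s) ^ 2
        = (u ^ 2 - 2 * v ^ 2) * (s ^ 2 - 2 * t ^ 2)"
      by (simp add: algebra_simps power2_eq_square)
    then have "(u * s + 2 * v * t) ^ 2 - 2 * (u * t + v * s) ^ 2 = 1" using uv st by simp
    moreover have "y'' = y * (u * s + 2 * v * t) + 2 * z * (u * t + v * s)"
      "z'' = y * (u * t + v * s) + z * (u * s + 2 * v * t)"
      unfolding y'' z'' y' z' by (simp_all add: algebra_simps)
    ultimately show "((y, z), (y'', z'')) \<in> pell_equiv N"
      unfolding pell_equiv_iff using N by blast
  qed
qed

lemma image_quotient_class: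
  assumes "X \<in> A // R" and "surj f"
    and iff: "\<And>x y. (f x, f y) \<in> S \<longleftrightarrow> (x, y) \<in> R"
    and AB: "\<And>x. x \<in> A \<Longrightarrow> f x \<in> B"
  shows "f ` X \<in> B // S"
proof -
  obtain x where x: "x \<in> A" "X = R `` {x}" using assms(1) by (rule quotientE)
  have "f ` X = S `` {f x}"
  proof
    show "f ` X \<subseteq> S `` {f x}" using x(2) iff by auto
    show "S `` {f x} \<subseteq> f ` X"
    proof
      fix y assume y: "y \<in> S `` {f x}"
      obtain w where "y = f w" using \<open>surj f\<close> by (rule surjE)
      with y x(2) iff show "y \<in> f ` X" by auto
    qed
  qed
  then show ?thesis using AB[OF x(1)] by (simp add: quotientI)
qed


section \<open>Conjugation and multiplication by \<open>\<surd>2 - 1\<close>\<close>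

lemma conjugate_pell_equiv:
  assumes "((y, z), (y', z')) \<in> pell_equiv N"
  shows "((y, - z), (y', - z')) \<in> pell_equiv N"
proof -
  obtain u v where N: "y ^ 2 - 2 * z ^ 2 = N" "y' ^ 2 - 2 * z' ^ 2 = N"
    and uv: "u ^ 2 - 2 * v ^ 2 = 1" and eqs: "y' = y * u + 2 * z * v" "z' = y * v + z * u"
    using assms by (auto simp: pell_equiv_iff)
  have "u ^ 2 - 2 * (- v) ^ 2 = 1" "y' = y * u + 2 * (- z) * (- v)" "- z' = y * (- v) + (- z) * u"
    using uv eqs by simp_all
  moreover have "y ^ 2 - 2 * (- z) ^ 2 = N" "y' ^ 2 - 2 * (- z') ^ 2 = N" using N by simp_all
  ultimately show ?thesis unfolding pell_equiv_iff by blast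
qed

lemma conjugate_class_in_pell_classes:
  assumes "K \<in> pell_classes N"
  shows "conjugate_class K \<in> pell_classes N"
  unfolding pell_classes_def conjugate_class_def
proof (rule image_quotient_class)
  show "K \<in> pell_solutions N // pell_equiv N" using assms by (simp add: pell_classes_def)
  show "surj (\<lambda>(y :: int, z :: int). (y, - z))"
    by (rule surjI[where f = "\<lambda>(y, z). (y, - z)"]) auto
  show "((case x of (y, z) \<Rightarrow> (y, - z)), (case w of (y, z) \<Rightarrow> (y, - z))) \<in> pell_equiv N
      \<longleftrightarrow> (x, w) \<in> pell_equiv N" for x w
    using conjugate_pell_equiv[of "fst x" "snd x" "fst w" "snd w" N]
      conjugate_pell_equiv[of "fst x" "- snd x" "fst w" "- snd w" N]
    by (auto simp: case_prod_beta)
  show "(case x of (y, z) \<Rightarrow> (y, - z)) \<in> pell_solutions N" if "x \<in> pell_solutions N" for x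
    using that by (auto simp: pell_solutions_def)
qed

text \<open>The coordinates of \<open>(\<surd>2 - 1) (y + z \<surd>2)\<close>.\<close>

definition mult_unit :: "int \<times> int \<Rightarrow> int \<times> int" where
  "mult_unit = (\<lambda>(y, z). (2 * z - y, y - z))"

lemma mult_unit_norm:
  "(2 * z - y) ^ 2 - 2 * (y - z) ^ 2 = - (y ^ 2 - 2 * z ^ 2)" for y z :: int
  by (simp add: power2_eq_square algebra_simps)

text \<open>
  Multiplication by a fixed nonzero number can be cancelled, so the same unit of norm \<open>1\<close>
  relates two numbers and their multiples.
\<close>

lemma mult_unit_pell_equiv_iff:
  "(mult_unit p, mult_unit q) \<in> pell_equiv (- N) \<longleftrightarrow> (p, q) \<in> pell_equiv N"
proof -
  obtain y z y' z' where pq: "p = (y, z)" "q = (y', z')" by (metis surj_pair)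
  have "2 * z' - y' = (2 * z - y) * u + 2 * (y - z) * v \<and> y' - z' = (2 * z - y) * v + (y - z) * u
      \<longleftrightarrow> y' = y * u + 2 * z * v \<and> z' = y * v + z * u" for u v
    by (auto simp: algebra_simps)
  then show ?thesis
    unfolding pq mult_unit_def case_prod_conv pell_equiv_iff mult_unit_norm neg_equal_iff_equal
    by simp
qed

lemma mult_unit_image_class:
  assumes "K \<in> pell_classes N"
  shows "mult_unit ` K \<in> pell_classes (- N)"
  unfolding pell_classes_def
proof (rule image_quotient_class)
  show "K \<in> pell_solutions N // pell_equiv N" using assms by (simp add: pell_classes_def)
  \<comment> \<open>The inverse map is multiplication by \<open>\<surd>2 + 1\<close>.\<close>
  show "surj mult_unit"
    by (rule surjI[where f = "\<lambda>(y, z). (y + 2 * z, y + z)"]) (auto simp: mult_unit_def)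
  show "(mult_unit x, mult_unit w) \<in> pell_equiv (- N) \<longleftrightarrow> (x, w) \<in> pell_equiv N" for x w
    by (rule mult_unit_pell_equiv_iff)
  show "mult_unit x \<in> pell_solutions (- N)" if "x \<in> pell_solutions N" for x
    using that mult_unit_norm by (auto simp: pell_solutions_def mult_unit_def)
qed

lemma mult_unit_conjugate_equiv:
  assumes "(y, z) \<in> pell_solutions N"
  shows "((2 * z - y, - (y - z)), mult_unit (y, - z)) \<in> pell_equiv (- N)"
proof -
  have "(2 * z - y) ^ 2 - 2 * (- (y - z)) ^ 2 = - N"
    "(2 * (- z) - y) ^ 2 - 2 * (y - (- z)) ^ 2 = - N"
    using assms by (auto simp: pell_solutions_def power2_eq_square algebra_simps)
  \<comment> \<open>The unit \<open>-3 + 2 \<surd>2\<close> is the quotient of \<open>\<surd>2 - 1\<close> by its conjugate \<open>- \<surd>2 - 1\<close>.\<close>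
  moreover have "(-3) ^ 2 - 2 * 2 ^ 2 = (1 :: int)"
    "2 * (- z) - y = (2 * z - y) * (-3) + 2 * (- (y - z)) * 2"
    "y - (- z) = (2 * z - y) * 2 + (- (y - z)) * (-3)"
    by (simp_all add: algebra_simps)
  ultimately show ?thesis
    unfolding mult_unit_def case_prod_conv pell_equiv_iff by blast
qed

text \<open>Both sides are classes, so it is enough that they contain equivalent elements.\<close>

lemma mult_unit_conjugate_class:
  assumes K: "K \<in> pell_classes N"
  shows "mult_unit ` conjugate_class K = conjugate_class (mult_unit ` K)"
proof -
  have "K \<noteq> {}" and sub: "K \<subseteq> pell_solutions N"
    using K in_quotient_imp_non_empty[OF equiv_pell_equiv]
      in_quotient_imp_subset[OF equiv_pell_equiv]
    unfolding pell_classes_def by blast+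
  then obtain y z where yz: "(y, z) \<in> K" by (metis ex_in_conv surj_pair)
  have "(2 * z - y, - (y - z)) \<in> conjugate_class (mult_unit ` K)"
    using yz by (force simp: conjugate_class_def mult_unit_def)
  moreover have "mult_unit (y, - z) \<in> mult_unit ` conjugate_class K"
    using yz by (force simp: conjugate_class_def)
  moreover have "((2 * z - y, - (y - z)), mult_unit (y, - z)) \<in> pell_equiv (- N)"
    using yz sub by (intro mult_unit_conjugate_equiv) auto
  moreover have "conjugate_class (mult_unit ` K) \<in> pell_solutions (- N) // pell_equiv (- N)"
    "mult_unit ` conjugate_class K \<in> pell_solutions (- N) // pell_equiv (- N)"
    using K conjugate_class_in_pell_classes mult_unit_image_class
    unfolding pell_classes_def by blast+
  ultimately show ?thesis
    using quotient_eq_iff[OF equiv_pell_equiv] by metis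
qed


section \<open>Balancer pairs as unit multiples of balancing pairs\<close>

lemma double_sum_interval: "2 * (\<Sum>j = B + 1..B + r. j) = r * (2 * B + r + 1)" for B r :: nat
  by (induction r) (simp_all add: algebra_simps)

lemma balancer_square:
  assumes "is_upper_gap_balancer k B r"
  shows "(2 * real B + 2 * real r + 1) ^ 2
    = 8 * real B ^ 2 + 8 * (1 - real k) * real B + (2 * real k - 1) ^ 2"
proof -
  obtain d where d: "B = k + d"
    using assms unfolding is_upper_gap_balancer_def by (metis le_Suc_ex)
  have "d * (d + 1) = r * (2 * B + r + 1)"
    using assms double_sum_interval[of 0 d] double_sum_interval[of B r] d
    by (simp add: is_upper_gap_balancer_def)
  then have "real (d * (d + 1)) = real (r * (2 * B + r + 1))" by (simp only:)
  then have "real r * (2 * real B + real r + 1) - real d * (real d + 1) = 0"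
    by (simp add: algebra_simps)
  moreover have "(2 * real B + 2 * real r + 1) ^ 2
      - (8 * real B ^ 2 + 8 * (1 - real k) * real B + (2 * real k - 1) ^ 2)
      = 4 * (real r * (2 * real B + real r + 1) - real d * (real d + 1))"
    unfolding d by (simp add: power2_eq_square algebra_simps)
  ultimately show ?thesis by simp
qed

lemma lucas_balancing_eq:
  assumes "is_upper_gap_balancer k B r"
  shows "upper_gap_lucas_balancing k B = 2 * real B + 2 * real r + 1"
  unfolding upper_gap_lucas_balancing_def balancer_square[OF assms, symmetric] by simp

text \<open>
  With \<open>C = 2 B + 2 r + 1\<close> and \<open>z = 2 B + 1 - k\<close> the radicand of the Lucas-balancer is
  \<open>(2 z - C)\<^sup>2\<close>.  The sign is determined by \<open>C\<^sup>2 = 4 z\<^sup>2 - (2 z\<^sup>2 - 2 k\<^sup>2 + 1)\<close>,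
  in which \<open>z > k\<close>, so that \<open>C < 2 z\<close>.
\<close>

lemma lucas_balancer_eq:
  assumes "is_upper_gap_balancer k B r"
  shows "upper_gap_lucas_balancer k r = 2 * real B + 1 - 2 * real k - 2 * real r"
proof -
  define C z where "C = 2 * real B + 2 * real r + 1" and "z = 2 * real B + 1 - real k"
  have kB: "real k \<le> real B" using assms by (simp add: is_upper_gap_balancer_def)
  have norm: "C ^ 2 - 2 * z ^ 2 = 2 * real k ^ 2 - 1"
    using balancer_square[OF assms] unfolding C_def z_def
    by (simp add: power2_eq_square algebra_simps)
  have "real k ^ 2 \<le> z ^ 2" using kB unfolding z_def by (intro power_mono) simp_all
  then have "C ^ 2 \<le> (2 * z) ^ 2" using norm by (simp add: power_mult_distrib)
  then have nonneg: "0 \<le> 2 * z - C"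
    using kB power2_le_imp_le[of C "2 * z"] by (simp add: z_def)
  have "2 * (C - z) ^ 2 - (2 * real k ^ 2 - 1) = (2 * z - C) ^ 2"
    unfolding norm[symmetric] by (simp add: power2_eq_square algebra_simps)
  moreover have "C - z = 2 * real r + real k" by (simp add: C_def z_def)
  ultimately have "8 * real r ^ 2 + 8 * real k * real r + 1 = (2 * z - C) ^ 2"
    by (simp add: power2_eq_square algebra_simps)
  then have "upper_gap_lucas_balancer k r = 2 * z - C"
    unfolding upper_gap_lucas_balancer_def using nonneg by simp
  then show ?thesis by (simp add: C_def z_def)
qed

lemma balancer_pair_is_unit_multiple:
  assumes "is_upper_gap_balancer k B r"
    and "(upper_gap_lucas_balancing k B, 2 * real B + 1 - real k)
      = map_prod real_of_int real_of_int x"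
  shows "(upper_gap_lucas_balancer k r, 2 * real r + real k)
    = map_prod real_of_int real_of_int (mult_unit x)"
  using assms(2)
  by (cases x) (auto simp: mult_unit_def lucas_balancing_eq[OF assms(1)]
      lucas_balancer_eq[OF assms(1)] algebra_simps)

text \<open>
  Only the first \<open>C i\<close> is a Lucas-balancing number by definition; the later ones are given by
  the recursion, which is multiplication of \<open>C + z \<surd>2\<close> by the unit \<open>3 + 2 \<surd>2\<close> of norm \<open>1\<close>.
  Norm and positivity are preserved, and they determine \<open>C i\<close> from \<open>B i\<close>.
\<close>

lemma balancing_class_lucas:
  assumes "upper_gap_balancing_class k B C" and kB: "\<And>i. k \<le> B i"
  shows "C i = upper_gap_lucas_balancing k (B i)"
proof -
  have C0: "C 0 = upper_gap_lucas_balancing k (B 0)"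
    and bal0: "upper_gap_balancing k (B 0)"
    and rec: "real (B (Suc i)) = 3 * real (B i) + C i + 1 - real k"
      "C (Suc i) = 8 * real (B i) + 3 * C i + 4 - 4 * real k" for i
    using assms(1) by (simp_all add: upper_gap_balancing_class_def upper_gap_balancing_pair_def)
  define rad where "rad b = 8 * b ^ 2 + 8 * (1 - real k) * b + (2 * real k - 1) ^ 2" for b :: real
  have "0 \<le> C i \<and> C i ^ 2 = rad (real (B i))"
  proof (induction i)
    case 0
    obtain r where r: "is_upper_gap_balancer k (B 0) r"
      using bal0 by (auto simp: upper_gap_balancing_def)
    show ?case
      using balancer_square[OF r] unfolding C0 lucas_balancing_eq[OF r] rad_def by simp
  next
    case (Suc i)
    have "0 \<le> C (Suc i)" unfolding rec(2) using Suc.IH kB[of i] by simp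
    moreover have "C (Suc i) ^ 2 - rad (real (B (Suc i))) = C i ^ 2 - rad (real (B i))"
      unfolding rec rad_def by (simp add: power2_eq_square algebra_simps)
    ultimately show ?case using Suc.IH by simp
  qed
  then show ?thesis
    unfolding upper_gap_lucas_balancing_def rad_def by (metis real_sqrt_unique)
qed

lemma balancer_class_lies_in:
  assumes cls: "upper_gap_balancer_class_of k B C r rh"
    and K: "lies_in (\<lambda>i. (C i, 2 * real (B i) + 1 - real k)) K"
  shows "lies_in (\<lambda>i. (rh i, 2 * real (r i) + real k)) (mult_unit ` K)"
  unfolding lies_in_def
proof (rule image_subsetI)
  fix i
  have r: "is_upper_gap_balancer k (B i) (r i)" "rh i = upper_gap_lucas_balancer k (r i)" for i
    using cls by (simp_all add: upper_gap_balancer_class_of_def upper_gap_balancer_pair_of_def)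
  have C: "C i = upper_gap_lucas_balancing k (B i)"
  proof (rule balancing_class_lucas[of k B C])
    show "upper_gap_balancing_class k B C"
      using cls by (simp add: upper_gap_balancer_class_of_def)
    show "k \<le> B j" for j using r(1)[of j] by (simp add: is_upper_gap_balancer_def)
  qed
  obtain x where x: "x \<in> K"
    "(C i, 2 * real (B i) + 1 - real k) = map_prod real_of_int real_of_int x"
  proof -
    have "(C i, 2 * real (B i) + 1 - real k) \<in> map_prod real_of_int real_of_int ` K"
      using K unfolding lies_in_def by (rule subsetD) (rule rangeI)
    then show thesis by (rule imageE) (rule that)
  qed
  have "(rh i, 2 * real (r i) + real k) = map_prod real_of_int real_of_int (mult_unit x)"
    unfolding r(2) by (rule balancer_pair_is_unit_multiple[OF r(1) x(2)[unfolded C]])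
  then show "(rh i, 2 * real (r i) + real k) \<in> map_prod real_of_int real_of_int ` mult_unit ` K"
    by (rule image_eqI) (rule imageI[OF x(1)])
qed

theorem theorem4p7:
  fixes k :: nat
    and B B' r r' :: "nat \<Rightarrow> nat"
    and C C' rh rh' :: "nat \<Rightarrow> real"
  assumes "upper_gap_balancing_class k B C"
    and "upper_gap_balancing_class k B' C'"
    and "conjugate_balancing_classes k B C B' C'"
    and "upper_gap_balancer_class_of k B C r rh"
    and "upper_gap_balancer_class_of k B' C' r' rh'"
  shows "conjugate_balancer_classes k r rh r' rh'"
proof -
  let ?N = "2 * int k ^ 2 - 1"
  obtain K where K: "K \<in> pell_classes ?N" "conjugate_class K \<in> pell_classes ?N"
    and lies: "lies_in (\<lambda>i. (C i, 2 * real (B i) + 1 - real k)) K"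
      "lies_in (\<lambda>i. (C' i, 2 * real (B' i) + 1 - real k)) (conjugate_class K)"
    using assms(3) unfolding conjugate_balancing_classes_def conjugate_sequences_def by blast
  have "lies_in (\<lambda>i. (rh i, 2 * real (r i) + real k)) (mult_unit ` K)"
    using assms(4) lies(1) by (rule balancer_class_lies_in)
  moreover have "lies_in (\<lambda>i. (rh' i, 2 * real (r' i) + real k)) (mult_unit ` conjugate_class K)"
    using assms(5) lies(2) by (rule balancer_class_lies_in)
  moreover have "mult_unit ` conjugate_class K = conjugate_class (mult_unit ` K)"
    using K(1) by (rule mult_unit_conjugate_class)
  moreover have "mult_unit ` K \<in> pell_classes (- ?N)"
    "mult_unit ` conjugate_class K \<in> pell_classes (- ?N)"
    using K[THEN mult_unit_image_class] .
  ultimately show ?thesis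
    unfolding conjugate_balancer_classes_def conjugate_sequences_def by blast
qed

end
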